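(* Let $\varepsilon\in(0,2)$. There exist a finite simple graph $G=(V,E)$, vectors $w,z\in\mathbb{R}_+^E$, as well as $(1,x)$ and $(\mu,Y)$ witnessing the membership $(w,z)\in H(G)$, such that, for the random sequence $(\mu_t)_{t\in\mathbb{N}}$ obtained by repeated sampling from $\mathrm{GWrv}(Y)$, $$\mathbb{E}\big(\min\{t\in\mathbb{N} : \mu_t<+\infty\}\big)\ \ge\ \Big(\frac{2\sqrt\varepsilon}{\pi}+O(\varepsilon^{3/2})\Big)^{-1},$$ where the implied constant in $O(\cdot)$ is absolute.
   Context: $\mathbf 1$ is the all-ones vector; $A\succeq B$ means $A-B$ is positive semidefinite; $\mathbb{S}^V_+$ is the cone of positive semidefinite symmetric $V\times V$ matrices; $\mathcal L_G(w):=\sum_{ij\in E}w_{ij}(e_i-e_j)(e_i-e_j)^T$ and $(\mathcal L_G^*(Y))_{ij}=Y_{ii}+Y_{jj}-Y_{ij}-Y_{ji}$ for $ij\in E$. For $S\subseteq V$, $\delta(S)$ is the set of edges with exactly one endpoint in $S$ and $\chi^{\delta(S)}$ its incidence vector. $H(G)$ is the set of pairs $(w,z)\in\mathbb{R}_+^E\times\mathbb{R}_+^E$ for which there exist $(\rho,x)\in\mathbb{R}_+\times\mathbb{R}^V$ with $\rho\ge\mathbf 1^Tx$ and $\mathrm{Diag}(x)\succeq\frac14\mathcal L_G(w)$, and $(\mu,Y)\in\mathbb{R}_+\times\mathbb{S}^V_+$ with $\mathrm{diag}(Y)=\mu\mathbf 1$ and $\frac14\mathcal L_G^*(Y)\ge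 z$, such that $w^Tz\ge\rho\mu$. Such $(\rho,x)$ and $(\mu,Y)$ are said to witness the membership $(w,z)\in H(G)$. For a positive semidefinite $Y$ with constant diagonal, $\mathrm{GWrv}(Y)$ is the random subset $\{i\in V : e_i^TY^{1/2}h\ge0\}$ of $V$, where $Y^{1/2}$ is the positive semidefinite square root and $h\in\mathbb{R}^V$ is a uniformly distributed unit vector. Repeated sampling: $\hat y_0:=0\in\mathbb{R}^{\mathcal P(V)}$ and, for $t\ge1$, $\hat y_t:=\hat y_{t-1}+e_{S(t)}$, where $S(1),S(2),\dots$ are independent samples of $\mathrm{GWrv}(Y)$; and $\mu_t:=\inf\{\nu\in\mathbb{R}_+ : \nu\sum_{S\subseteq V}(\hat y_t)_S\,\chi^{\delta(S)}\ge z\}$, with $\inf\emptyset=+\infty$. *)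

theory Defs
  imports "HOL-Probability.Probability"
begin

text \<open>
  Vectors in \<open>\<real>\<^sup>V\<close> and matrices in \<open>\<real>\<^sup>V\<^sup>\<times>\<^sup>V\<close> over a finite vertex set \<open>V\<close> are functions
  on the ambient type of which only the values on \<open>V\<close> matter; vectors in \<open>\<real>\<^sup>E\<close> are functions on
  two-element sets of which only the values on \<open>E\<close> matter.
\<close>

definition simple_graph :: "'v set \<Rightarrow> 'v set set \<Rightarrow> bool" where
  "simple_graph V E \<longleftrightarrow> finite V \<and> (\<forall>e\<in>E. e \<subseteq> V \<and> card e = 2)"

definition psd :: "'v set \<Rightarrow> ('v \<Rightarrow> 'v \<Rightarrow> real) \<Rightarrow> bool" where
  "psd V A \<longleftrightarrow> (\<forall>i\<in>V. \<forall>j\<in>V. A i j = A j i) \<and>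
     (\<forall>v :: 'v \<Rightarrow> real. 0 \<le> (\<Sum>i\<in>V. \<Sum>j\<in>V. v i * A i j * v j))"

definition loewner_ge :: "'v set \<Rightarrow> ('v \<Rightarrow> 'v \<Rightarrow> real) \<Rightarrow> ('v \<Rightarrow> 'v \<Rightarrow> real) \<Rightarrow> bool" where
  "loewner_ge V A B \<longleftrightarrow> psd V (\<lambda>i j. A i j - B i j)"

definition diag_mat :: "('v \<Rightarrow> real) \<Rightarrow> 'v \<Rightarrow> 'v \<Rightarrow> real" where
  "diag_mat x i j = (if i = j then x i else 0)"

definition unit_vec :: "'v \<Rightarrow> 'v \<Rightarrow> real" where
  "unit_vec i u = (if u = i then 1 else 0)"

text \<open>The restriction to \<open>i < j\<close> makes every edge \<open>{i, j}\<close> contribute exactly once.\<close>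

definition laplacian ::
  "'v::linorder set \<Rightarrow> 'v set set \<Rightarrow> ('v set \<Rightarrow> real) \<Rightarrow> 'v \<Rightarrow> 'v \<Rightarrow> real" where
  "laplacian V E w u v =
     (\<Sum>(i, j) \<in> {(i, j). i \<in> V \<and> j \<in> V \<and> i < j \<and> {i, j} \<in> E}.
        w {i, j} * ((unit_vec i u - unit_vec j u) * (unit_vec i v - unit_vec j v)))"

definition laplacian_adj :: "('v \<Rightarrow> 'v \<Rightarrow> real) \<Rightarrow> 'v \<Rightarrow> 'v \<Rightarrow> real" where
  "laplacian_adj Y i j = Y i i + Y j j - Y i j - Y j i"

definition H_witness ::
  "'v::linorder set \<Rightarrow> 'v set set \<Rightarrow> ('v set \<Rightarrow> real) \<Rightarrow> ('v set \<Rightarrow> real) \<Rightarrow>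
   real \<Rightarrow> ('v \<Rightarrow> real) \<Rightarrow> real \<Rightarrow> ('v \<Rightarrow> 'v \<Rightarrow> real) \<Rightarrow> bool" where
  "H_witness V E w z \<rho> x \<mu> Y \<longleftrightarrow>
     0 \<le> \<rho> \<and> (\<Sum>i\<in>V. x i) \<le> \<rho> \<and>
     loewner_ge V (diag_mat x) (\<lambda>i j. 1 / 4 * laplacian V E w i j) \<and>
     0 \<le> \<mu> \<and> psd V Y \<and> (\<forall>i\<in>V. Y i i = \<mu>) \<and>
     (\<forall>i j. {i, j} \<in> E \<longrightarrow> z {i, j} \<le> 1 / 4 * laplacian_adj Y i j) \<and>
     \<rho> * \<mu> \<le> (\<Sum>e\<in>E. w e * z e)"

definition H_set ::
  "'v::linorder set \<Rightarrow> 'v set set \<Rightarrow> (('v set \<Rightarrow> real) \<times> ('v set \<Rightarrow> real)) set" where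
  "H_set V E = {(w, z). (\<forall>e\<in>E. 0 \<le> w e) \<and> (\<forall>e\<in>E. 0 \<le> z e) \<and>
     (\<exists>\<rho> x \<mu> Y. H_witness V E w z \<rho> x \<mu> Y)}"

text \<open>The entries outside \<open>V \<times> V\<close> are fixed to \<open>0\<close> so that the square root is unique as a function.\<close>

definition psd_sqrt :: "'v set \<Rightarrow> ('v \<Rightarrow> 'v \<Rightarrow> real) \<Rightarrow> 'v \<Rightarrow> 'v \<Rightarrow> real" where
  "psd_sqrt V Y = (THE B. psd V B \<and>
     (\<forall>i\<in>V. \<forall>j\<in>V. (\<Sum>k\<in>V. B i k * B k j) = Y i j) \<and>
     (\<forall>i j. i \<notin> V \<or> j \<notin> V \<longrightarrow> B i j = 0))"

definition vec_norm :: "'v set \<Rightarrow> ('v \<Rightarrow> real) \<Rightarrow> real" where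
  "vec_norm V h = sqrt (\<Sum>i\<in>V. (h i)\<^sup>2)"

text \<open>
  The uniform distribution on the unit sphere of \<open>\<real>\<^sup>V\<close>: the measure of a set of unit vectors is the
  fraction of the volume of the unit ball filled by the cone over it. That is, a uniformly
  distributed point of the unit ball is normalised (the origin is a null set).
\<close>

definition uniform_sphere :: "'v set \<Rightarrow> ('v \<Rightarrow> real) measure" where
  "uniform_sphere V =
     distr (uniform_measure (\<Pi>\<^sub>M i\<in>V. lborel)
              {h \<in> space (\<Pi>\<^sub>M i\<in>V. lborel). vec_norm V h \<le> 1})
           (\<Pi>\<^sub>M i\<in>V. borel) (\<lambda>h. \<lambda>i\<in>V. h i / vec_norm V h)"

definition GW_subset :: "'v set \<Rightarrow> ('v \<Rightarrow> 'v \<Rightarrow> real) \<Rightarrow> ('v \<Rightarrow> real) \<Rightarrow> 'v set" where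
  "GW_subset V Y h = {i \<in> V. 0 \<le> (\<Sum>k\<in>V. psd_sqrt V Y i k * h k)}"

definition GWrv :: "'v set \<Rightarrow> ('v \<Rightarrow> 'v \<Rightarrow> real) \<Rightarrow> 'v set measure" where
  "GWrv V Y = distr (uniform_sphere V) (count_space (Pow V)) (GW_subset V Y)"

text \<open>The joint law of the independent samples \<open>S 1, S 2, \<dots>\<close>\<close>

definition GW_samples :: "'v set \<Rightarrow> ('v \<Rightarrow> 'v \<Rightarrow> real) \<Rightarrow> (nat \<Rightarrow> 'v set) measure" where
  "GW_samples V Y = (\<Pi>\<^sub>M t\<in>{1..}. GWrv V Y)"

definition cut :: "'v set set \<Rightarrow> 'v set \<Rightarrow> 'v set set" where
  "cut E A = {e \<in> E. card (e \<inter> A) = 1}"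

primrec sample_count :: "(nat \<Rightarrow> 'v set) \<Rightarrow> nat \<Rightarrow> 'v set \<Rightarrow> real" where
  "sample_count S 0 = (\<lambda>A. 0)"
| "sample_count S (Suc t) = (\<lambda>A. sample_count S t A + (if A = S (Suc t) then 1 else 0))"

definition sample_mu ::
  "'v set \<Rightarrow> 'v set set \<Rightarrow> ('v set \<Rightarrow> real) \<Rightarrow> (nat \<Rightarrow> 'v set) \<Rightarrow> nat \<Rightarrow> ereal" where
  "sample_mu V E z S t =
     Inf (ereal ` {\<nu>. 0 \<le> \<nu> \<and>
       (\<forall>e\<in>E. z e \<le> \<nu> * (\<Sum>A\<in>Pow V. sample_count S t A * indicator (cut E A) e))})"

text \<open>The value is \<open>\<infinity>\<close> on samples for which \<open>\<mu>\<^sub>t\<close> never becomes finite.\<close>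

definition first_finite_time ::
  "'v set \<Rightarrow> 'v set set \<Rightarrow> ('v set \<Rightarrow> real) \<Rightarrow> (nat \<Rightarrow> 'v set) \<Rightarrow> ennreal" where
  "first_finite_time V E z S = (INF t \<in> {t. sample_mu V E z S t < \<infinity>}. of_nat t)"

definition expected_first_finite_time ::
  "'v set \<Rightarrow> 'v set set \<Rightarrow> ('v set \<Rightarrow> real) \<Rightarrow> ('v \<Rightarrow> 'v \<Rightarrow> real) \<Rightarrow> ennreal" where
  "expected_first_finite_time V E z Y = (\<integral>\<^sup>+ S. first_finite_time V E z S \<partial>GW_samples V Y)"

end

theory Submission imports Defs begin

text \<open>
  A demand \<open>z\<close> may be positive on an edge of weight \<open>0\<close>, where duality does not force it to be tight.
  Take four unit directions \<open>a, -a, b, -b\<close> with \<open>a\<close> and \<open>b\<close> almost parallel, put all the weight on the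
  edge joining \<open>a\<close> and \<open>-a\<close>, and give the edge joining \<open>a\<close> and \<open>b\<close> weight \<open>0\<close> and a small positive
  demand. A sample cuts the latter edge only if \<open>h\<close> lies in a thin slab, so the probability \<open>p\<close> of a cut
  can be made arbitrarily small. Until the first cut \<open>\<mu>\<^sub>t = \<infinity>\<close>, and by the union bound no cut happens in
  the first \<open>N\<close> samples with probability at least \<open>1 - N p\<close>; with \<open>p \<le> 1 / (2 N)\<close> the expected time is
  at least \<open>N / 2\<close>. As the angle is not tied to \<open>\<epsilon>\<close>, no error term is needed.
\<close>

section \<open>Uniqueness of the positive semidefinite square root\<close>

text \<open>With \<open>u = A v\<close>, the form at \<open>v + t u\<close> equals
  \<open>2 t S + t^2 K\<close>, where \<open>S\<close> is the squared norm of \<open>u\<close>. For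
  small negative \<open>t\<close> the linear term dominates, so nonnegativity forces
  \<open>S = 0\<close>.\<close>

lemma psd_kernel:
  assumes "finite V" and A: "psd V A" and v: "(\<Sum>i\<in>V. \<Sum>j\<in>V. v i * A i j * v j) = 0" and i: "i \<in> V"
  shows "(\<Sum>j\<in>V. A i j * v j) = 0"
proof -
  define u where "u i = (\<Sum>j\<in>V. A i j * v j)" for i
  define K where "K = (\<Sum>i\<in>V. \<Sum>j\<in>V. u i * A i j * u j)"
  define S where "S = (\<Sum>i\<in>V. (u i)\<^sup>2)"
  have sym: "A i j = A j i" if "i \<in> V" "j \<in> V" for i j
    using A that by (auto simp: psd_def)
  have uv: "(\<Sum>i\<in>V. \<Sum>j\<in>V. u i * A i j * v j) = S"
    by (simp add: S_def u_def sum_distrib_left power2_eq_square mult.assoc)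
  have "(\<Sum>i\<in>V. \<Sum>j\<in>V. v i * A i j * u j) = (\<Sum>j\<in>V. \<Sum>i\<in>V. v i * A i j * u j)"
    by (rule sum.swap)
  also have "\<dots> = S"
    unfolding uv[symmetric] by (intro sum.cong refl) (simp add: sym mult_ac)
  finally have vu: "(\<Sum>i\<in>V. \<Sum>j\<in>V. v i * A i j * u j) = S" .
  have form: "0 \<le> 2 * t * S + t\<^sup>2 * K" for t
  proof -
    have "0 \<le> (\<Sum>i\<in>V. \<Sum>j\<in>V. (v i + t * u i) * A i j * (v j + t * u j))"
      using A by (auto simp: psd_def)
    also have "\<dots> = (\<Sum>i\<in>V. \<Sum>j\<in>V. v i * A i j * v j) + t * (\<Sum>i\<in>V. \<Sum>j\<in>V. v i * A i j * u j)
        + t * (\<Sum>i\<in>V. \<Sum>j\<in>V. u i * A i j * v j) + t\<^sup>2 * K"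
      by (simp add: K_def sum_distrib_left sum.distrib[symmetric] algebra_simps power2_eq_square)
    finally show ?thesis unfolding uv vu v by (simp add: algebra_simps)
  qed
  have K: "0 \<le> K" using A by (auto simp: psd_def K_def)
  \<comment> \<open>At \<open>t = - q\<close> the form is \<open>- q^2 (K + 2)\<close>. The
    denominator \<open>K + 1\<close> keeps the quotient meaningful when
    \<open>K = 0\<close>.\<close>
  define q where "q = S / (K + 1)"
  have S: "S = q * (K + 1)" using K by (simp add: q_def)
  have "q\<^sup>2 * (K + 2) \<le> 0"
    using form[of "- q"] unfolding S by (simp add: algebra_simps power2_eq_square)
  then have "S = 0"
    using K by (auto simp: S mult_le_0_iff)
  then show ?thesis
    using i \<open>finite V\<close> by (simp add: S_def sum_nonneg_eq_0_iff u_def)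
qed

text \<open>
  With \<open>D = B - C\<close>, the identity \<open>B D + D C = B\<^sup>2 - C\<^sup>2 = 0\<close> gives \<open>tr (D B D) + tr (D C D) = 0\<close>.
  Both traces are nonnegative, so \<open>B\<close> and \<open>C\<close> annihilate the columns of \<open>D\<close>, whence \<open>D\<^sup>2 = 0\<close>.
\<close>

lemma psd_sqrt_unique:
  assumes V: "finite V" and B: "psd V B" and C: "psd V C"
    and eq: "\<And>i j. i \<in> V \<Longrightarrow> j \<in> V \<Longrightarrow> (\<Sum>k\<in>V. B i k * B k j) = (\<Sum>k\<in>V. C i k * C k j)"
    and ij: "i \<in> V" "j \<in> V"
  shows "B i j = C i j"
proof -
  define D where "D i j = B i j - C i j" for i j
  define Q where "Q A j = (\<Sum>i\<in>V. \<Sum>k\<in>V. D i j * A i k * D k j)" for A :: "'a \<Rightarrow> 'a \<Rightarrow> real" and j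
  have symB: "B i j = B j i" if "i \<in> V" "j \<in> V" for i j using B that by (auto simp: psd_def)
  have symC: "C i j = C j i" if "i \<in> V" "j \<in> V" for i j using C that by (auto simp: psd_def)
  have symD: "D i j = D j i" if "i \<in> V" "j \<in> V" for i j
    using symB symC that by (simp add: D_def)
  have QB: "0 \<le> Q B j" and QC: "0 \<le> Q C j" for j
    using B C by (auto simp: psd_def Q_def)
  have "(\<Sum>j\<in>V. Q C j) = (\<Sum>j\<in>V. \<Sum>i\<in>V. D j i * (\<Sum>k\<in>V. D j k * C k i))"
    unfolding Q_def sum_distrib_left
    by (intro sum.cong refl) (auto simp: symD symC mult_ac)
  moreover have "(\<Sum>j\<in>V. Q B j) = (\<Sum>i\<in>V. \<Sum>j\<in>V. D i j * (\<Sum>k\<in>V. B i k * D k j))"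
    unfolding Q_def sum_distrib_left by (subst sum.swap) (simp add: mult_ac)
  ultimately have "(\<Sum>j\<in>V. Q B j + Q C j) =
      (\<Sum>i\<in>V. \<Sum>j\<in>V. D i j * (\<Sum>k\<in>V. B i k * D k j + D i k * C k j))"
    by (simp add: sum.distrib distrib_left)
  also have "\<dots> = (\<Sum>i\<in>V. \<Sum>j\<in>V. D i j * ((\<Sum>k\<in>V. B i k * B k j) - (\<Sum>k\<in>V. C i k * C k j)))"
    unfolding sum_subtractf[symmetric] D_def by (intro sum.cong refl) (simp add: algebra_simps)
  also have "\<dots> = 0" by (simp add: eq)
  finally have "Q B j + Q C j = 0"
    using V QB QC ij(2) by (subst (asm) sum_nonneg_eq_0_iff) (auto simp: add_nonneg_nonneg)
  then have "Q B j = 0" "Q C j = 0" using QB[of j] QC[of j] by linarith+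
  then have "(\<Sum>k\<in>V. B l k * D k j) = 0" "(\<Sum>k\<in>V. C l k * D k j) = 0" if "l \<in> V" for l
    using psd_kernel[OF V B, of "\<lambda>i. D i j"] psd_kernel[OF V C, of "\<lambda>i. D i j"] that
    by (auto simp: Q_def)
  then have "(\<Sum>k\<in>V. D j k * D k j) = 0"
    using ij(2) by (simp add: D_def[of j] left_diff_distrib sum_subtractf)
  moreover have "(\<Sum>k\<in>V. D j k * D k j) = (\<Sum>k\<in>V. (D k j)\<^sup>2)"
    using ij(2) by (intro sum.cong refl) (simp add: symD power2_eq_square)
  ultimately show ?thesis
    using V ij(1) by (simp add: sum_nonneg_eq_0_iff D_def)
qed

text \<open>Evaluates the \<open>THE\<close> in \<open>psd_sqrt\<close> once an explicit root is at
  hand. Uniqueness settles the entries on \<open>V\<close>, and the convention of zero entries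
  elsewhere settles the rest of the function.\<close>

lemma psd_sqrt_eqI:
  assumes "finite V" "psd V B"
    and "\<And>i j. i \<in> V \<Longrightarrow> j \<in> V \<Longrightarrow> (\<Sum>k\<in>V. B i k * B k j) = Y i j"
    and "\<And>i j. i \<notin> V \<or> j \<notin> V \<Longrightarrow> B i j = 0"
  shows "psd_sqrt V Y = B"
  unfolding psd_sqrt_def
proof (rule the_equality)
  fix C assume "psd V C \<and> (\<forall>i\<in>V. \<forall>j\<in>V. (\<Sum>k\<in>V. C i k * C k j) = Y i j) \<and>
     (\<forall>i j. i \<notin> V \<or> j \<notin> V \<longrightarrow> C i j = 0)"
  then have C: "psd V C" "\<And>i j. i \<in> V \<Longrightarrow> j \<in> V \<Longrightarrow> (\<Sum>k\<in>V. C i k * C k j) = Y i j"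
    "\<And>i j. i \<notin> V \<or> j \<notin> V \<Longrightarrow> C i j = 0"
    by auto
  show "C = B"
  proof (intro ext)
    fix i j
    show "C i j = B i j"
    proof (cases "i \<in> V \<and> j \<in> V")
      case True
      then show ?thesis
        using psd_sqrt_unique[OF assms(1) C(1) assms(2)] C(2) assms(3) by simp
    next
      case False
      then show ?thesis using C(3) assms(4) by simp
    qed
  qed
qed (use assms in auto)

section \<open>The unit ball and the uniform law on the sphere\<close>

definition unit_ball :: "'v set \<Rightarrow> ('v \<Rightarrow> real) set" where
  "unit_ball V = {h \<in> space (\<Pi>\<^sub>M i\<in>V. lborel). vec_norm V h \<le> 1}"

lemma measurable_vec_norm [measurable]:
  "vec_norm V \<in> borel_measurable (\<Pi>\<^sub>M i\<in>V. lborel)"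
  unfolding vec_norm_def by measurable

lemma sets_unit_ball [measurable]: "unit_ball V \<in> sets (\<Pi>\<^sub>M i\<in>V. lborel)"
  unfolding unit_ball_def by measurable

lemma unit_ball_abs_le:
  assumes "finite V" "h \<in> unit_ball V" "i \<in> V"
  shows "\<bar>h i\<bar> \<le> 1"
proof -
  have "(h i)\<^sup>2 \<le> (\<Sum>i\<in>V. (h i)\<^sup>2)"
    using assms by (intro member_le_sum) auto
  also have "\<dots> \<le> 1" using assms by (simp add: unit_ball_def vec_norm_def)
  finally show ?thesis by (simp add: abs_square_le_1)
qed

lemma emeasure_cube:
  assumes "finite V" "0 \<le> a"
  shows "emeasure (\<Pi>\<^sub>M i\<in>V. lborel) (\<Pi>\<^sub>E i\<in>V. {-a..a :: real}) = ennreal ((2 * a) ^ card V)"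
proof -
  interpret product_sigma_finite "\<lambda>_::'a. lborel :: real measure" ..
  show ?thesis using assms by (subst emeasure_PiM) (auto simp: prod_ennreal ennreal_power)
qed

text \<open>With \<open>n = card V\<close>, the cube of half-width \<open>1 / n\<close> fits into
  the ball, since \<open>n\<close> squares of size at most \<open>1 / n^2\<close> add up to at most
  \<open>1\<close>. This crude bound is enough for a cut probability that is linear in the width of
  a slab.\<close>

lemma emeasure_unit_ball_ge:
  assumes "finite V"
  shows "ennreal ((2 / card V) ^ card V) \<le> emeasure (\<Pi>\<^sub>M i\<in>V. lborel) (unit_ball V)"
proof -
  have "(\<Pi>\<^sub>E i\<in>V. {-(1 / card V)..1 / card V}) \<subseteq> unit_ball V"
  proof
    fix h :: "'a \<Rightarrow> real" assume h: "h \<in> (\<Pi>\<^sub>E i\<in>V. {-(1 / card V)..1 / card V})"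
    have "(\<Sum>i\<in>V. (h i)\<^sup>2) \<le> (\<Sum>i\<in>V. 1 / card V)"
    proof (rule sum_mono)
      fix i assume i: "i \<in> V"
      then have c: "1 \<le> card V" using assms by (metis One_nat_def Suc_leI card_gt_0_iff empty_iff)
      have "\<bar>h i\<bar> \<le> 1 / card V" using h i by (auto simp: PiE_iff abs_le_iff)
      then have "\<bar>h i\<bar>\<^sup>2 \<le> (1 / card V)\<^sup>2" by (intro power_mono) auto
      also have "\<dots> \<le> 1 / card V" using c by (simp add: field_simps power2_eq_square)
      finally show "(h i)\<^sup>2 \<le> 1 / card V" by simp
    qed
    also have "\<dots> \<le> 1" by simp
    finally show "h \<in> unit_ball V"
      using h by (auto simp: unit_ball_def vec_norm_def space_PiM PiE_iff)
  qed
  then have "emeasure (\<Pi>\<^sub>M i\<in>V. lborel) (\<Pi>\<^sub>E i\<in>V. {-(1 / card V)..1 / card V})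
      \<le> emeasure (\<Pi>\<^sub>M i\<in>V. lborel) (unit_ball V)"
    by (intro emeasure_mono sets_unit_ball)
  then show ?thesis
    using emeasure_cube[OF assms, of "1 / card V"] by simp
qed

lemma unit_ball_subset_cube:
  assumes "finite V"
  shows "unit_ball V \<subseteq> (\<Pi>\<^sub>E i\<in>V. {-1..1})"
proof
  fix h assume h: "h \<in> unit_ball V"
  then have "h \<in> extensional V" by (simp add: unit_ball_def space_PiM PiE_iff)
  moreover have "h i \<in> {-1..1}" if "i \<in> V" for i
    using unit_ball_abs_le[OF assms h that] by (simp add: abs_le_iff)
  ultimately show "h \<in> (\<Pi>\<^sub>E i\<in>V. {-1..1})" by (simp add: PiE_iff)
qed

text \<open>Positive and finite volume of the ball make \<open>uniform_measure\<close> a probability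
  measure.\<close>

lemma emeasure_unit_ball_pos:
  assumes "finite V"
  shows "emeasure (\<Pi>\<^sub>M i\<in>V. lborel) (unit_ball V) > 0"
proof -
  have "0 < (2 / real (card V)) ^ card V"
    \<comment> \<open>For empty \<open>V\<close> the base \<open>2 / 0\<close> is \<open>0\<close>,
      but the exponent \<open>0\<close> makes the power \<open>1\<close>.\<close>
    by (cases "card V = 0") auto
  then show ?thesis
    using emeasure_unit_ball_ge[OF assms] by (metis ennreal_less_zero_iff order_less_le_trans)
qed

lemma emeasure_unit_ball_finite:
  assumes "finite V"
  shows "emeasure (\<Pi>\<^sub>M i\<in>V. lborel) (unit_ball V) < \<infinity>"
proof -
  have "emeasure (\<Pi>\<^sub>M i\<in>V. lborel) (unit_ball V) \<le> emeasure (\<Pi>\<^sub>M i\<in>V. lborel) (\<Pi>\<^sub>E i\<in>V. {-1..1::real})"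
    using assms by (intro emeasure_mono unit_ball_subset_cube sets_PiM_I_finite) auto
  also have "\<dots> < \<infinity>" using emeasure_cube[OF assms, of 1] by simp
  finally show ?thesis .
qed

lemma normalise_measurable [measurable]:
  "(\<lambda>h. \<lambda>i\<in>V. h i / vec_norm V h) \<in> (\<Pi>\<^sub>M i\<in>V. lborel) \<rightarrow>\<^sub>M (\<Pi>\<^sub>M i\<in>V. borel)"
  by measurable

lemma uniform_sphere_unit_ball:
  "uniform_sphere V = distr (uniform_measure (\<Pi>\<^sub>M i\<in>V. lborel) (unit_ball V))
     (\<Pi>\<^sub>M i\<in>V. borel) (\<lambda>h. \<lambda>i\<in>V. h i / vec_norm V h)"
  by (simp add: uniform_sphere_def unit_ball_def)

lemma prob_space_uniform_sphere:
  assumes "finite V"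
  shows "prob_space (uniform_sphere V)"
  unfolding uniform_sphere_unit_ball
  using emeasure_unit_ball_pos[OF assms] emeasure_unit_ball_finite[OF assms]
  by (intro prob_space.prob_space_distr prob_space_uniform_measure) auto

lemma sets_uniform_sphere [measurable_cong]:
  "sets (uniform_sphere V) = sets (\<Pi>\<^sub>M i\<in>V. borel)"
  by (simp add: uniform_sphere_def)

section \<open>The sampled subset as a random variable\<close>

text \<open>As \<open>Pow V\<close> is finite, preimages of singletons suffice. Each is a sign
  pattern, that is, a finite intersection of half-spaces and their complements.\<close>

lemma GW_subset_measurable:
  assumes "finite V"
  shows "GW_subset V Y \<in> (\<Pi>\<^sub>M i\<in>V. borel) \<rightarrow>\<^sub>M count_space (Pow V)"
proof (subst measurable_count_space_eq2)
  show "finite (Pow V)" using assms by simp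
  show "GW_subset V Y \<in> space (\<Pi>\<^sub>M i\<in>V. borel) \<rightarrow> Pow V \<and>
    (\<forall>A\<in>Pow V. GW_subset V Y -` {A} \<inter> space (\<Pi>\<^sub>M i\<in>V. borel) \<in> sets (\<Pi>\<^sub>M i\<in>V. borel))"
  proof (intro conjI ballI)
    show "GW_subset V Y \<in> space (\<Pi>\<^sub>M i\<in>V. borel) \<rightarrow> Pow V" by (auto simp: GW_subset_def)
  next
    fix A assume A: "A \<in> Pow V"
    have "GW_subset V Y h = A \<longleftrightarrow> (\<forall>i\<in>V. (0 \<le> (\<Sum>k\<in>V. psd_sqrt V Y i k * h k)) \<longleftrightarrow> i \<in> A)" for h
      using A unfolding GW_subset_def by blast
    then have "GW_subset V Y -` {A} \<inter> space (\<Pi>\<^sub>M i\<in>V. borel) =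
      {h \<in> space (\<Pi>\<^sub>M i\<in>V. borel). \<forall>i\<in>V. (0 \<le> (\<Sum>k\<in>V. psd_sqrt V Y i k * h k)) \<longleftrightarrow> i \<in> A}"
      by blast
    also have "\<dots> \<in> sets (\<Pi>\<^sub>M i\<in>V. borel)"
    proof (intro sets.sets_Collect_finite_All assms)
      fix i
      have "(\<lambda>h. \<Sum>k\<in>V. psd_sqrt V Y i k * h k) \<in> borel_measurable (\<Pi>\<^sub>M i\<in>V. borel)"
        by measurable
      then show "{h \<in> space (\<Pi>\<^sub>M i\<in>V. borel). (0 \<le> (\<Sum>k\<in>V. psd_sqrt V Y i k * h k)) \<longleftrightarrow> i \<in> A}
          \<in> sets (\<Pi>\<^sub>M i\<in>V. borel)"
        by (cases "i \<in> A") simp_all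
    qed
    finally show "GW_subset V Y -` {A} \<inter> space (\<Pi>\<^sub>M i\<in>V. borel) \<in> sets (\<Pi>\<^sub>M i\<in>V. borel)" .
  qed
qed

lemma prob_space_GWrv:
  assumes "finite V"
  shows "prob_space (GWrv V Y)"
  unfolding GWrv_def
  using assms GW_subset_measurable[OF assms, of Y]
  by (intro prob_space.prob_space_distr prob_space_uniform_sphere)
     (simp_all cong: measurable_cong_sets add: sets_uniform_sphere)

section \<open>Volume of a slab in the cube\<close>

text \<open>Fubini along coordinate \<open>i\<close>: once the other coordinates are fixed, the slab
  leaves to \<open>h i\<close> an interval of length \<open>2 * s / \<bar>c i\<bar>\<close>, and the
  others range over a cube of volume \<open>2 ^ (card V - 1)\<close>.\<close>

lemma emeasure_cube_strip_le:
  assumes V: "finite V" and i: "i \<in> V" "c i \<noteq> 0" and s: "0 \<le> s"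
  shows "emeasure (\<Pi>\<^sub>M k\<in>V. lborel) {h \<in> (\<Pi>\<^sub>E k\<in>V. {-1..1}). \<bar>\<Sum>k\<in>V. c k * h k\<bar> \<le> s}
    \<le> ennreal (2 ^ card V * s / \<bar>c i\<bar>)"
    (is "emeasure _ ?A \<le> _")
proof -
  interpret product_sigma_finite "\<lambda>_::'a. lborel :: real measure" ..
  define I where "I = V - {i}"
  have VI: "V = insert i I" "finite I" "i \<notin> I" using V i by (auto simp: I_def)
  have A_eq: "?A = {h \<in> space (\<Pi>\<^sub>M k\<in>V. lborel). (\<forall>k\<in>V. h k \<in> {-1..1}) \<and> \<bar>\<Sum>k\<in>V. c k * h k\<bar> \<le> s}"
    by (auto simp: space_PiM PiE_iff)
  have A: "?A \<in> sets (\<Pi>\<^sub>M k\<in>V. lborel)"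
    unfolding A_eq using V by measurable
  have inner: "(\<integral>\<^sup>+ y. indicator ?A (x(i := y)) \<partial>lborel)
      \<le> ennreal (2 * s / \<bar>c i\<bar>) * indicator (\<Pi>\<^sub>E k\<in>I. {-1..1}) x"
    if x: "x \<in> space (\<Pi>\<^sub>M k\<in>I. lborel)" for x
  proof -
    \<comment> \<open>The value of coordinate \<open>i\<close> at which the linear form vanishes:
      the centre of the interval.\<close>
    define r where "r = - (\<Sum>k\<in>I. c k * x k) / c i"
    have "y \<in> {r - s / \<bar>c i\<bar>..r + s / \<bar>c i\<bar>} \<and> x \<in> (\<Pi>\<^sub>E k\<in>I. {-1..1})"
      if y: "x(i := y) \<in> ?A" for y
    proof -
      have "(\<Sum>k\<in>V. c k * (x(i := y)) k) = c i * y + (\<Sum>k\<in>I. c k * x k)"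
        using VI by (simp add: sum.insert) (intro sum.cong, auto)
      also have "\<dots> = c i * (y - r)"
        using i by (simp add: r_def field_simps)
      finally have "\<bar>c i\<bar> * \<bar>y - r\<bar> \<le> s" using y by (simp add: abs_mult)
      then have "\<bar>y - r\<bar> \<le> s / \<bar>c i\<bar>" using i by (simp add: field_simps)
      moreover have "x k \<in> {-1..1}" if k: "k \<in> I" for k
      proof -
        have "x(i := y) \<in> (\<Pi>\<^sub>E k\<in>V. {-1..1})" using y by blast
        moreover have "k \<in> V" using k by (simp add: I_def)
        ultimately have "(x(i := y)) k \<in> {-1..1}" by (rule PiE_mem)
        moreover have "k \<noteq> i" using k VI(3) by blast
        ultimately show ?thesis by simp
      qed
      ultimately show ?thesis
        using x by (auto simp: space_PiM PiE_iff abs_le_iff)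
    qed
    then have "(\<integral>\<^sup>+ y. indicator ?A (x(i := y)) \<partial>lborel)
      \<le> (\<integral>\<^sup>+ y. indicator {r - s / \<bar>c i\<bar>..r + s / \<bar>c i\<bar>} y * indicator (\<Pi>\<^sub>E k\<in>I. {-1..1}) x \<partial>lborel)"
      by (intro nn_integral_mono) (auto simp: indicator_def)
    also have "\<dots> = ennreal (2 * s / \<bar>c i\<bar>) * indicator (\<Pi>\<^sub>E k\<in>I. {-1..1}) x"
      using s by (subst nn_integral_multc) auto
    finally show ?thesis .
  qed
  have "emeasure (\<Pi>\<^sub>M k\<in>V. lborel) ?A = (\<integral>\<^sup>+ h. indicator ?A h \<partial>(\<Pi>\<^sub>M k\<in>V. lborel))"
    using A by simp
  also have "\<dots> = (\<integral>\<^sup>+ x. (\<integral>\<^sup>+ y. indicator ?A (x(i := y)) \<partial>lborel) \<partial>(\<Pi>\<^sub>M k\<in>I. lborel))"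
    using A VI by (simp only: VI(1)) (intro product_nn_integral_insert, auto)
  also have "\<dots> \<le> (\<integral>\<^sup>+ x. ennreal (2 * s / \<bar>c i\<bar>) * indicator (\<Pi>\<^sub>E k\<in>I. {-1..1::real}) x \<partial>(\<Pi>\<^sub>M k\<in>I. lborel))"
    by (rule nn_integral_mono) (rule inner)
  also have "\<dots> = ennreal (2 * s / \<bar>c i\<bar>) * emeasure (\<Pi>\<^sub>M k\<in>I. lborel) (\<Pi>\<^sub>E k\<in>I. {-1..1::real})"
    using VI by (intro nn_integral_cmult_indicator sets_PiM_I_finite) auto
  also have "\<dots> = ennreal (2 ^ card V * s / \<bar>c i\<bar>)"
    using VI s emeasure_cube[of I 1] by (simp add: ennreal_mult[symmetric])
  finally show ?thesis .
qed

section \<open>Waiting time until an edge is cut\<close>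

lemma sample_count_eq_0:
  assumes "\<And>k. k \<in> {1..t} \<Longrightarrow> S k \<noteq> A"
  shows "sample_count S t A = 0"
  using assms
proof (induction t)
  case (Suc t)
  have "S (Suc t) \<noteq> A" using Suc.prems by simp
  moreover have "sample_count S t A = 0" by (intro Suc.IH Suc.prems) simp
  ultimately show ?case by auto
qed simp

text \<open>If no sample so far cuts \<open>e\<close>, coordinate \<open>e\<close> of the
  accumulated sum is \<open>0\<close>. No \<open>\<nu>\<close> can then reach the positive demand,
  and the infimum is over the empty set.\<close>

lemma sample_mu_eq_infinity:
  assumes e: "e \<in> E" "0 < z e" and S: "\<And>k. k \<in> {1..t} \<Longrightarrow> e \<notin> cut E (S k)"
  shows "sample_mu V E z S t = \<infinity>"
proof -
  have "(\<Sum>A\<in>Pow V. sample_count S t A * indicator (cut E A) e) = 0"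
    using S by (intro sum.neutral) (auto simp: indicator_def intro!: sample_count_eq_0)
  then have *: "{\<nu>. 0 \<le> \<nu> \<and> (\<forall>e\<in>E. z e \<le> \<nu> * (\<Sum>A\<in>Pow V. sample_count S t A * indicator (cut E A) e))} = {}"
    using e by force
  show ?thesis unfolding sample_mu_def * by (simp add: top_ereal_def)
qed

text \<open>By the union bound, the event \<open>U\<close> that one of the first \<open>N\<close>
  samples cuts \<open>e\<close> has probability at most \<open>1 / 2\<close>. Off \<open>U\<close>
  the waiting time is at least \<open>N\<close>, so its expectation is at least
  \<open>N / 2\<close>.\<close>

lemma expected_first_finite_time_ge:
  fixes N :: nat
  assumes V: "finite V" and e: "e \<in> E" "0 < z e"
    and p: "2 * N * measure (GWrv V Y) {A \<in> Pow V. e \<in> cut E A} \<le> 1"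
  shows "ennreal (N / 2) \<le> expected_first_finite_time V E z Y"
proof -
  let ?M = "GW_samples V Y" and ?C = "{A \<in> Pow V. e \<in> cut E A}"
  interpret G: prob_space "GWrv V Y" using V by (rule prob_space_GWrv)
  interpret P: product_prob_space "\<lambda>_::nat. GWrv V Y" "{1..}" ..
  interpret M: prob_space ?M unfolding GW_samples_def by (rule P.prob_space_axioms)
  have space: "space (GWrv V Y) = Pow V" and sets: "sets (GWrv V Y) = Pow (Pow V)"
    by (simp_all add: GWrv_def)
  define B where "B k = {S \<in> space ?M. S k \<in> ?C}" for k
  have B: "B k \<in> sets ?M" "measure ?M (B k) = measure (GWrv V Y) ?C" if "k \<in> {1..N}" for k
  proof -
    show "B k \<in> sets ?M"
      unfolding B_def GW_samples_def using that sets
      by (intro sets_Collect_single) auto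
    have "emeasure ?M (B k) = emeasure (GWrv V Y) ?C"
      unfolding B_def GW_samples_def using that sets
      by (intro P.emeasure_PiM_Collect_single) auto
    then show "measure ?M (B k) = measure (GWrv V Y) ?C" by (simp add: measure_def)
  qed
  define U where "U = (\<Union>k\<in>{1..N}. B k)"
  have U: "U \<in> sets ?M" using B by (auto simp: U_def)
  have "measure ?M U \<le> (\<Sum>k\<in>{1..N}. measure ?M (B k))"
    unfolding U_def using B by (intro M.finite_measure_subadditive_finite) auto
  also have "\<dots> = N * measure (GWrv V Y) ?C" using B by simp
  finally have "2 * measure ?M U \<le> 1" using p by linarith
  then have "1 / 2 \<le> measure ?M (space ?M - U)"
    using M.prob_compl[OF U] by simp
  then have "N / 2 \<le> N * measure ?M (space ?M - U)"
    using mult_left_mono[of "1 / 2" "measure ?M (space ?M - U)" "real N"] by simp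
  then have "ennreal (N / 2) \<le> ennreal (N * measure ?M (space ?M - U))"
    by (rule ennreal_leI)
  also have "\<dots> = of_nat N * emeasure ?M (space ?M - U)"
    by (simp add: M.emeasure_eq_measure ennreal_mult ennreal_of_nat_eq_real_of_nat)
  also have "\<dots> = (\<integral>\<^sup>+ S. of_nat N * indicator (space ?M - U) S \<partial>?M)"
    using U by (subst nn_integral_cmult_indicator) auto
  also have "\<dots> \<le> (\<integral>\<^sup>+ S. first_finite_time V E z S \<partial>?M)"
  proof (intro nn_integral_mono)
    fix S assume S: "S \<in> space ?M"
    show "of_nat N * indicator (space ?M - U) S \<le> first_finite_time V E z S"
    proof (cases "S \<in> U")
      case False
      have "e \<notin> cut E (S k)" if "k \<in> {1..N}" for k
      proof -
        have "S k \<in> Pow V"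
          using S that by (auto simp: GW_samples_def space_PiM PiE_iff space)
        then show ?thesis using False S that by (auto simp: U_def B_def)
      qed
      \<comment> \<open>For \<open>t \<le> N\<close> the samples \<open>1..t\<close> all miss
        \<open>e\<close>, so \<open>sample_mu\<close> is infinite at \<open>t\<close>;
        \<open>t = 0\<close> is covered by the empty range.\<close>
      then have "N < t" if "sample_mu V E z S t < \<infinity>" for t
        using sample_mu_eq_infinity[of e E z t S V] e that by (cases "N < t") auto
      then have "of_nat N \<le> first_finite_time V E z S"
        unfolding first_finite_time_def by (intro INF_greatest) (force intro: less_imp_le)
      then show ?thesis using False S by simp
    qed simp
  qed
  finally show ?thesis by (simp add: expected_first_finite_time_def)
qed

section \<open>Cut probabilities as volume ratios\<close>

text \<open>Pulled back along the normalisation, the event \<open>C\<close> becomes a subset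
  \<open>D\<close> of the space, and its probability is the share of the ball lying in
  \<open>D\<close>. That part lies in \<open>T\<close>, and the ball is at least as large as its
  inscribed cube.\<close>

lemma measure_GWrv_le:
  assumes V: "finite V" and C: "C \<subseteq> Pow V" and T: "T \<in> sets (\<Pi>\<^sub>M i\<in>V. lborel)"
    and t: "emeasure (\<Pi>\<^sub>M i\<in>V. lborel) T \<le> ennreal t" "0 \<le> t"
    and sub: "\<And>h. h \<in> unit_ball V \<Longrightarrow> GW_subset V Y (\<lambda>i\<in>V. h i / vec_norm V h) \<in> C \<Longrightarrow> h \<in> T"
  shows "measure (GWrv V Y) C \<le> t / (2 / card V) ^ card V"
proof -
  let ?L = "\<Pi>\<^sub>M i\<in>V. lborel :: real measure"
  let ?n = "\<lambda>h. \<lambda>i\<in>V. h i / vec_norm V h"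
  define b where "b = (2 / real (card V)) ^ card V"
  have b: "0 < b" unfolding b_def by (cases "card V = 0") auto
  define D where "D = {h \<in> space ?L. GW_subset V Y (?n h) \<in> C}"
  define m where "m = measure ?L (unit_ball V)"
  have m: "emeasure ?L (unit_ball V) = ennreal m"
    using emeasure_unit_ball_finite[OF V] by (simp add: m_def emeasure_eq_ennreal_measure)
  have bm: "b \<le> m"
    using emeasure_unit_ball_ge[OF V] unfolding m b_def[symmetric]
    by (simp add: m_def)
  have GWn: "(\<lambda>h. GW_subset V Y (?n h)) \<in> ?L \<rightarrow>\<^sub>M count_space (Pow V)"
    by (rule measurable_compose[OF normalise_measurable GW_subset_measurable[OF V]])
  then have D: "D \<in> sets ?L"
    using measurable_sets[OF GWn, of C] C by (simp add: D_def vimage_def Int_def conj_commute)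
  have GWs: "GW_subset V Y \<in> uniform_sphere V \<rightarrow>\<^sub>M count_space (Pow V)"
    using GW_subset_measurable[OF V] by (simp cong: measurable_cong_sets add: sets_uniform_sphere)
  have GWD: "GWrv V Y = distr (uniform_measure ?L (unit_ball V)) (count_space (Pow V)) (\<lambda>h. GW_subset V Y (?n h))"
    unfolding GWrv_def uniform_sphere_unit_ball
    using GW_subset_measurable[OF V] normalise_measurable
    by (subst distr_distr) (auto simp: comp_def)
  have "emeasure (GWrv V Y) C = emeasure (uniform_measure ?L (unit_ball V)) D"
    unfolding GWD using GWn C
    by (subst emeasure_distr) (auto simp: D_def vimage_def Int_def conj_commute)
  also have "\<dots> = emeasure ?L (unit_ball V \<inter> D) / emeasure ?L (unit_ball V)"
    using D by (intro emeasure_uniform_measure) auto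
  also have "\<dots> \<le> ennreal t / ennreal m"
    unfolding m
    by (intro divide_right_mono_ennreal order.trans[OF emeasure_mono[OF _ T] t(1)])
       (auto simp: D_def intro: sub)
  also have "\<dots> = ennreal (t / m)"
    using b bm t by (simp add: divide_ennreal)
  also have "\<dots> \<le> ennreal (t / b)"
    using b bm t by (intro ennreal_leI divide_left_mono) auto
  finally have "emeasure (GWrv V Y) C \<le> ennreal (t / b)" .
  then show ?thesis
    unfolding b_def[symmetric] measure_def
    using b t by (intro enn2real_leI) auto
qed

section \<open>The four-vertex instance and its Gram matrix\<close>

text \<open>For symmetric \<open>B\<close> the quadratic form of \<open>B^2\<close> at
  \<open>v\<close> is the squared norm of \<open>B v\<close>.\<close>

lemma psd_square:
  assumes "finite V" and sym: "\<And>i j. i \<in> V \<Longrightarrow> j \<in> V \<Longrightarrow> B i j = B j i"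
  shows "psd V (\<lambda>i j. \<Sum>k\<in>V. B i k * B k j)"
  unfolding psd_def
proof (intro conjI ballI allI)
  fix i j assume "i \<in> V" "j \<in> V"
  then show "(\<Sum>k\<in>V. B i k * B k j) = (\<Sum>k\<in>V. B j k * B k i)"
    by (intro sum.cong refl) (simp add: sym mult.commute)
next
  fix v :: "'a \<Rightarrow> real"
  have "(\<Sum>i\<in>V. \<Sum>j\<in>V. v i * (\<Sum>k\<in>V. B i k * B k j) * v j) =
      (\<Sum>i\<in>V. \<Sum>j\<in>V. \<Sum>k\<in>V. v i * B k i * (B k j * v j))"
    unfolding sum_distrib_left sum_distrib_right
    by (intro sum.cong refl) (simp add: sym mult_ac)
  also have "\<dots> = (\<Sum>i\<in>V. \<Sum>k\<in>V. \<Sum>j\<in>V. v i * B k i * (B k j * v j))"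
    by (intro sum.cong refl sum.swap)
  also have "\<dots> = (\<Sum>k\<in>V. \<Sum>i\<in>V. \<Sum>j\<in>V. v i * B k i * (B k j * v j))"
    by (rule sum.swap)
  also have "\<dots> = (\<Sum>k\<in>V. (\<Sum>i\<in>V. v i * B k i)\<^sup>2)"
    by (intro sum.cong refl) (simp add: power2_eq_square sum_product mult_ac)
  finally show "0 \<le> (\<Sum>i\<in>V. \<Sum>j\<in>V. v i * (\<Sum>k\<in>V. B i k * B k j) * v j)"
    by (simp add: sum_nonneg)
qed

text \<open>
  The matrix \<open>[[1 + s, 1 - s], [1 - s, 1 + s]] \<otimes> [[1, -1], [-1, 1]]\<close>: the Gram matrix is defined through its
  square root, so that the latter is explicit.
\<close>

definition slim_root :: "real \<Rightarrow> nat \<Rightarrow> nat \<Rightarrow> real" where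
  "slim_root s i j = (if i < 4 \<and> j < 4
     then (if i div 2 = j div 2 then 1 + s else 1 - s) * (if i mod 2 = j mod 2 then 1 else -1)
     else 0)"

definition slim_gram :: "real \<Rightarrow> nat \<Rightarrow> nat \<Rightarrow> real" where
  "slim_gram s i j = (\<Sum>k\<in>{0, 1, 2, 3}. slim_root s i k * slim_root s k j)"

lemma slim_root_sym: "slim_root s i j = slim_root s j i"
  by (auto simp: slim_root_def)

text \<open>On \<open>V\<close> the matrix is \<open>p p^T + s d d^T\<close> with
  \<open>p = (1, -1, 1, -1)\<close> and \<open>d = (1, -1, -1, 1)\<close>, so its form is a sum of
  two squares with nonnegative coefficients.\<close>

lemma psd_slim_root:
  assumes "0 \<le> s"
  shows "psd {0, 1, 2, 3} (slim_root s)"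
  unfolding psd_def
proof (intro conjI ballI allI)
  fix v :: "nat \<Rightarrow> real"
  have "(\<Sum>i\<in>{0, 1, 2, 3}. \<Sum>j\<in>{0, 1, 2, 3}. v i * slim_root s i j * v j)
      = (v 0 - v 1 + v 2 - v 3)\<^sup>2 + s * (v 0 - v 1 - v 2 + v 3)\<^sup>2"
    by (simp add: slim_root_def power2_eq_square algebra_simps)
  also have "0 \<le> \<dots>" using assms by simp
  finally show "0 \<le> (\<Sum>i\<in>{0, 1, 2, 3}. \<Sum>j\<in>{0, 1, 2, 3}. v i * slim_root s i j * v j)" .
qed (rule slim_root_sym)

lemma psd_sqrt_slim_gram:
  assumes "0 \<le> s"
  shows "psd_sqrt {0, 1, 2, 3} (slim_gram s) = slim_root s"
  using psd_slim_root[OF assms]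
  by (intro psd_sqrt_eqI) (auto simp: slim_gram_def slim_root_def)

text \<open>The entries met by the two edges. \<open>Suc 0\<close> is the form into which the
  simplifier turns \<open>1\<close>.\<close>

lemma slim_gram_simps:
  "i < 4 \<Longrightarrow> slim_gram s i i = 4 + 4 * s\<^sup>2"
  "slim_gram s 0 (Suc 0) = - (4 + 4 * s\<^sup>2)" "slim_gram s (Suc 0) 0 = - (4 + 4 * s\<^sup>2)"
  "slim_gram s 0 2 = 4 - 4 * s\<^sup>2" "slim_gram s 2 0 = 4 - 4 * s\<^sup>2"
proof -
  assume "i < 4"
  then have "i = 0 \<or> i = 1 \<or> i = 2 \<or> i = 3" by linarith
  then show "slim_gram s i i = 4 + 4 * s\<^sup>2"
    by (auto simp: slim_gram_def slim_root_def power2_eq_square algebra_simps)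
qed (simp_all add: slim_gram_def slim_root_def power2_eq_square algebra_simps)

text \<open>Rows \<open>0\<close> and \<open>2\<close> of the root give \<open>P + s D\<close> and
  \<open>P - s D\<close>. Opposite signs force
  \<open>\<bar>P\<bar> \<le> s \<bar>D\<bar> \<le> 4 s\<close>, a slab of volume at most
  \<open>2^4 * 4 s = 64 s\<close> in the cube. Dividing by \<open>(2 / 4)^4 = 1 / 16\<close> gives
  \<open>1024 s\<close>.\<close>

lemma measure_slim_gram_cut_le:
  assumes s: "0 \<le> s"
  shows "measure (GWrv {0, 1, 2, 3} (slim_gram s))
    {A \<in> Pow {0, 1, 2, 3}. {0, 2} \<in> cut E A} \<le> 1024 * s"
proof -
  let ?V = "{0, 1, 2, 3} :: nat set"
  define c :: "nat \<Rightarrow> real" where "c k = (if even k then 1 else -1)" for k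
  define T where "T = {h \<in> (\<Pi>\<^sub>E k\<in>?V. {-1..1}). \<bar>\<Sum>k\<in>?V. c k * h k\<bar> \<le> 4 * s}"
  have T_eq: "T = {h \<in> space (\<Pi>\<^sub>M k\<in>?V. lborel).
      (\<forall>k\<in>?V. h k \<in> {-1..1}) \<and> \<bar>\<Sum>k\<in>?V. c k * h k\<bar> \<le> 4 * s}"
    by (auto simp: T_def space_PiM PiE_iff)
  have "measure (GWrv ?V (slim_gram s)) {A \<in> Pow ?V. {0, 2} \<in> cut E A} \<le> 64 * s / (2 / card ?V) ^ card ?V"
  proof (rule measure_GWrv_le)
    show "T \<in> sets (\<Pi>\<^sub>M k\<in>?V. lborel)" unfolding T_eq by measurable
    show "emeasure (\<Pi>\<^sub>M k\<in>?V. lborel) T \<le> ennreal (64 * s)"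
      using emeasure_cube_strip_le[of ?V 0 c "4 * s"] s by (simp add: T_def c_def)
  next
    fix h :: "nat \<Rightarrow> real"
    define n where "n = vec_norm ?V h"
    let ?A = "GW_subset ?V (slim_gram s) (\<lambda>i\<in>?V. h i / vec_norm ?V h)"
    assume h: "h \<in> unit_ball ?V" and "?A \<in> {A \<in> Pow ?V. {0, 2} \<in> cut E A}"
    then have "card ({0, 2} \<inter> ?A) = 1" by (simp add: cut_def)
    then have A: "0 \<in> ?A \<longleftrightarrow> 2 \<notin> ?A"
      by (cases "0 \<in> ?A"; cases "2 \<in> ?A") auto
    define P where "P = h 0 - h 1 + h 2 - h 3"
    define D where "D = h 0 - h 1 - h 2 + h 3"
    have mem: "i \<in> ?A \<longleftrightarrow> 0 \<le> (\<Sum>k\<in>?V. slim_root s i k * h k) / n" if "i \<in> ?V" for i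
    proof -
      have "(\<Sum>k\<in>?V. slim_root s i k * (\<lambda>i\<in>?V. h i / vec_norm ?V h) k)
          = (\<Sum>k\<in>?V. slim_root s i k * h k) / n"
        unfolding sum_divide_distrib n_def by (intro sum.cong refl) (simp only: restrict_apply' times_divide_eq_right)
      then show ?thesis
        unfolding GW_subset_def psd_sqrt_slim_gram[OF s] mem_Collect_eq using that by (simp only: simp_thms)
    qed
    have rows: "(\<Sum>k\<in>?V. slim_root s 0 k * h k) = P + s * D" "(\<Sum>k\<in>?V. slim_root s 2 k * h k) = P - s * D"
      by (simp_all add: slim_root_def P_def D_def algebra_simps)
    have "0 \<in> ?A \<longleftrightarrow> 0 \<le> (P + s * D) / n" "2 \<in> ?A \<longleftrightarrow> 0 \<le> (P - s * D) / n"
      unfolding rows[symmetric] by (rule mem, simp)+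
    moreover have "0 \<le> n" by (simp add: n_def vec_norm_def)
    \<comment> \<open>If \<open>n = 0\<close>, both quotients are \<open>0\<close> by convention, so
      both vertices lie in \<open>?A\<close>, contradicting \<open>A\<close>. If
      \<open>n > 0\<close>, the division preserves signs.\<close>
    ultimately have "0 \<le> P + s * D \<longleftrightarrow> \<not> 0 \<le> P - s * D"
      using A by (cases "n = 0") (auto simp: zero_le_divide_iff)
    then have "\<bar>P\<bar> \<le> \<bar>s * D\<bar>" by linarith
    also have "\<dots> = s * \<bar>D\<bar>" using s by (simp add: abs_mult)
    also have "\<dots> \<le> s * 4"
    proof (intro mult_left_mono s)
      have "\<bar>h k\<bar> \<le> 1" if "k \<in> ?V" for k using unit_ball_abs_le[OF _ h that] by simp
      from this[of 0] this[of 1] this[of 2] this[of 3]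
      show "\<bar>D\<bar> \<le> 4" by (simp add: D_def)
    qed
    finally have "\<bar>\<Sum>k\<in>?V. c k * h k\<bar> \<le> 4 * s"
      by (simp add: c_def P_def algebra_simps)
    moreover have "h \<in> (\<Pi>\<^sub>E k\<in>?V. {-1..1})"
      using unit_ball_subset_cube[of ?V] h by blast
    ultimately show "h \<in> T" by (simp add: T_def)
  qed (use s in auto)
  then show ?thesis by (simp add: power_divide)
qed

definition slim_weight :: "nat set \<Rightarrow> real" where
  "slim_weight e = (if e = {0, 1} then 1 else 0)"

text \<open>On each of the two edges this is the largest demand that \<open>slim_gram s\<close>
  admits, namely a quarter of \<open>laplacian_adj\<close>.\<close>

definition slim_demand :: "real \<Rightarrow> nat set \<Rightarrow> real" where
  "slim_demand s e = (if e = {0, 1} then 4 + 4 * s\<^sup>2 else 4 * s\<^sup>2)"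

text \<open>All weight sits on \<open>{0, 1}\<close>, whose ends are antipodal, so
  \<open>w^T z\<close> equals \<open>\<mu>\<close>. The vector with \<open>1 / 2\<close> at both
  ends sums to \<open>1\<close>, and its slack matrix has the form
  \<open>(v 0 + v 1)^2 / 4\<close>.\<close>

lemma H_witness_slim:
  "H_witness {0, 1, 2, 3} {{0, 1}, {0, 2}} slim_weight (slim_demand s) 1
    (\<lambda>i. if i < 2 then 1 / 2 else 0) (4 + 4 * s\<^sup>2) (slim_gram s)"
  unfolding H_witness_def
proof (intro conjI allI impI ballI)
  let ?V = "{0, 1, 2, 3} :: nat set" and ?E = "{{0, 1}, {0, 2}} :: nat set set"
  have "{(i, j). i \<in> ?V \<and> j \<in> ?V \<and> i < j \<and> {i, j} \<in> ?E} = {(0, 1), (0, 2)}"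
    by (auto simp: doubleton_eq_iff)
  then have lap: "laplacian ?V ?E slim_weight i j =
      (unit_vec 0 i - unit_vec 1 i) * (unit_vec 0 j - unit_vec 1 j)" for i j
    by (simp add: laplacian_def slim_weight_def doubleton_eq_iff)
  show "loewner_ge ?V (diag_mat (\<lambda>i. if i < 2 then 1 / 2 else 0))
      (\<lambda>i j. 1 / 4 * laplacian ?V ?E slim_weight i j)"
    unfolding loewner_ge_def psd_def lap
  proof (intro conjI ballI allI)
    fix v :: "nat \<Rightarrow> real"
    have "(\<Sum>i\<in>?V. \<Sum>j\<in>?V. v i * (diag_mat (\<lambda>i. if i < 2 then 1 / 2 else 0) i j -
        1 / 4 * ((unit_vec 0 i - unit_vec 1 i) * (unit_vec 0 j - unit_vec 1 j))) * v j)
        = (v 0 + v 1)\<^sup>2 / 4"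
      by (simp add: diag_mat_def unit_vec_def power2_eq_square algebra_simps)
    also have "0 \<le> \<dots>" by simp
    finally show "0 \<le> (\<Sum>i\<in>?V. \<Sum>j\<in>?V. v i * (diag_mat (\<lambda>i. if i < 2 then 1 / 2 else 0) i j -
        1 / 4 * ((unit_vec 0 i - unit_vec 1 i) * (unit_vec 0 j - unit_vec 1 j))) * v j)" .
  qed (auto simp: diag_mat_def)
  show "psd ?V (slim_gram s)"
    unfolding slim_gram_def using slim_root_sym by (intro psd_square) auto
  show "slim_demand s {i, j} \<le> 1 / 4 * laplacian_adj (slim_gram s) i j" if "{i, j} \<in> ?E" for i j
    using that
    by (auto simp: doubleton_eq_iff slim_demand_def laplacian_adj_def slim_gram_simps)
  show "1 * (4 + 4 * s\<^sup>2) \<le> (\<Sum>e\<in>?E. slim_weight e * slim_demand s e)"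
    by (simp add: slim_weight_def slim_demand_def doubleton_eq_iff)
qed (auto simp: slim_gram_simps)

section \<open>Choice of the parameters\<close>

theorem proposition31:
  "\<exists>(C::real) (r :: real \<Rightarrow> real).
     (\<forall>\<epsilon>\<in>{0<..<2}. \<bar>r \<epsilon>\<bar> \<le> C * \<epsilon> powr (3 / 2)) \<and>
     (\<forall>\<epsilon>\<in>{0<..<2}.
        0 < 2 * sqrt \<epsilon> / pi + r \<epsilon> \<and>
        (\<exists>(V :: nat set) (E :: nat set set) (w :: nat set \<Rightarrow> real) (z :: nat set \<Rightarrow> real)
           (x :: nat \<Rightarrow> real) (\<mu> :: real) (Y :: nat \<Rightarrow> nat \<Rightarrow> real).
           simple_graph V E \<and> (w, z) \<in> H_set V E \<and> H_witness V E w z 1 x \<mu> Y \<and>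
           ennreal (inverse (2 * sqrt \<epsilon> / pi + r \<epsilon>)) \<le> expected_first_finite_time V E z Y))"
proof (intro exI[of _ "0 :: real"] exI[of _ "\<lambda>_. 0 :: real"] conjI ballI)
  fix \<epsilon> :: real assume \<epsilon>: "\<epsilon> \<in> {0<..<2}"
  then show "0 < 2 * sqrt \<epsilon> / pi + 0" by simp
  let ?V = "{0, 1, 2, 3} :: nat set" and ?E = "{{0, 1}, {0, 2}} :: nat set set"
  \<comment> \<open>The target is \<open>pi / (2 * sqrt \<epsilon>)\<close>, which is at most
    \<open>N / 2\<close> for this \<open>N\<close>.\<close>
  define N where "N = nat \<lceil>pi / sqrt \<epsilon>\<rceil>"
  have "0 < pi / sqrt \<epsilon>" using \<epsilon> by simp
  then have N: "0 < N" "pi / sqrt \<epsilon> \<le> N" unfolding N_def by (simp, linarith)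
  \<comment> \<open>Chosen so that \<open>2 * N * (1024 * s) = 1\<close>, the hypothesis on the cut
    probability.\<close>
  define s where "s = 1 / (2048 * real N)"
  have s: "0 < s" using N by (simp add: s_def)
  have "2 * N * measure (GWrv ?V (slim_gram s)) {A \<in> Pow ?V. {0, 2} \<in> cut ?E A} \<le> 2 * N * (1024 * s)"
    using s by (intro mult_left_mono measure_slim_gram_cut_le) auto
  also have "\<dots> = 1" using N by (simp add: s_def)
  finally have "ennreal (N / 2) \<le> expected_first_finite_time ?V ?E (slim_demand s) (slim_gram s)"
    using s by (intro expected_first_finite_time_ge[where e = "{0, 2}"])
      (auto simp: slim_demand_def doubleton_eq_iff)
  moreover have "inverse (2 * sqrt \<epsilon> / pi + 0) \<le> N / 2"
    using N by (simp add: divide_simps mult_ac)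
  ultimately have "ennreal (inverse (2 * sqrt \<epsilon> / pi + 0))
      \<le> expected_first_finite_time ?V ?E (slim_demand s) (slim_gram s)"
    by (meson ennreal_leI order_trans)
  moreover have "simple_graph ?V ?E" by (auto simp: simple_graph_def)
  moreover have "(slim_weight, slim_demand s) \<in> H_set ?V ?E"
    using H_witness_slim[of s] by (auto simp: H_set_def slim_weight_def slim_demand_def)
  ultimately show "\<exists>(V :: nat set) (E :: nat set set) (w :: nat set \<Rightarrow> real) (z :: nat set \<Rightarrow> real)
      (x :: nat \<Rightarrow> real) (\<mu> :: real) (Y :: nat \<Rightarrow> nat \<Rightarrow> real).
      simple_graph V E \<and> (w, z) \<in> H_set V E \<and> H_witness V E w z 1 x \<mu> Y \<and>
      ennreal (inverse (2 * sqrt \<epsilon> / pi + 0)) \<le> expected_first_finite_time V E z Y"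
    using H_witness_slim[of s] by blast
qed simp

end
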